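(* Let $d\ge 1$ be an integer and let $\kappa=(\nu,P,\tilde P,U)\in\mathcal K_d$, with $\phi_i,\tilde\phi_i,e_{i,j},\tilde e_{i,j},H,\tilde H$ and the antiautomorphism $\mathfrak a$ of $\mathfrak{sl}_{d+1}(\mathbb C)$ as defined in the context. Then $$\mathfrak a(\phi_i)=\phi_i,\qquad \mathfrak a(\tilde\phi_i)=\tilde\phi_i\qquad\text{for all }i=1,2,\dots,d,$$ $$\mathfrak a(e_{i,j})=\frac{\tilde p_j}{\tilde p_i}e_{j,i},\qquad \mathfrak a(\tilde e_{i,j})=\frac{p_j}{p_i}\tilde e_{j,i}\qquad\text{for all }0\le i\ne j\le d.$$ In particular, $\mathfrak a$ preserves the Cartan subalgebras $H$ and $\tilde H$.
   Context: $\mathcal K_d$ is the set of 4-tuples $(\nu,P,\tilde P,U)$ where $\nu$ is a nonzero complex number and $P,\tilde P,U$ are $(d+1)\times(d+1)$ complex matrices (rows and columns indexed by $0,\dots,d$) such that: (i) $P=\mathrm{diag}(p_0,\dots,p_d)$ and $\tilde P=\mathrm{diag}(\tilde p_0,\dots,\tilde p_d)$ with $p_0=\tilde p_0=1/\nu$; (ii) $U=(u_{i,j})_{0\le i,j\le d}$ with $u_{0,j}=u_{j,0}=1$ for all $j=0,\dots,d$; (iii) $\nu PU\tilde PU^t=I_{d+1}$. (All $p_j,\tilde p_j$ are then nonzero.) For $i,j\in\{0,\dots,d\}$, $e_{i,j}$ is the $(d+1)\times(d+1)$ matrix with $(i,j)$-entry $1$ and all other entries $0$. For $i=1,\dots,d$,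 $\phi_i=e_{i,i}-\frac1{d+1}I_{d+1}$; $H=\mathrm{span}\{\phi_1,\dots,\phi_d\}$ is the standard Cartan subalgebra of diagonal matrices in $\mathfrak{sl}_{d+1}(\mathbb C)$. Let $\tilde\theta\in\mathbb C$ be such that $R=\tilde\theta\tilde PU^t$ has $\det R=1$. Set $\tilde\phi_k=R\phi_kR^{-1}$ $(1\le k\le d)$, $\tilde e_{i,j}=Re_{i,j}R^{-1}$ $(0\le i,j\le d)$ and $\tilde H=\mathrm{span}\{\tilde\phi_1,\dots,\tilde\phi_d\}$. The antiautomorphism $\mathfrak a$ of $\mathfrak{sl}_{d+1}(\mathbb C)$ is defined by $\mathfrak a(\beta)=\tilde P\beta^t\tilde P^{-1}$. *)

theory Defs
  imports
    Complex_Main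
    "Jordan_Normal_Form.VS_Connect"
    "Jordan_Normal_Form.Gauss_Jordan_Elimination"
begin

text \<open>
  All matrices are complex \<open>(d+1) \<times> (d+1)\<close> matrices of the entry
  \<open>Jordan_Normal_Form\<close>; their indices run over \<open>0, \<dots>, d\<close>.
  A letter \<open>t\<close> appended to a name stands for a tilde: \<open>Pt\<close>, \<open>\<theta>t\<close>, \<open>\<phi>t\<close>, \<open>et\<close>, \<open>Ht\<close>.
  The diagonal entries \<open>p\<^sub>j\<close> and \<open>pt\<^sub>j\<close> are written \<open>P $$ (j,j)\<close> and \<open>Pt $$ (j,j)\<close>.
\<close>

definition K_set :: "nat \<Rightarrow> (complex \<times> complex mat \<times> complex mat \<times> complex mat) set" where
  "K_set d = {(\<nu>, P, Pt, U).
     \<nu> \<noteq> 0 \<and>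
     P \<in> carrier_mat (d+1) (d+1) \<and> Pt \<in> carrier_mat (d+1) (d+1) \<and> U \<in> carrier_mat (d+1) (d+1) \<and>
     diagonal_mat P \<and> diagonal_mat Pt \<and> P $$ (0,0) = 1 / \<nu> \<and> Pt $$ (0,0) = 1 / \<nu> \<and>
     (\<forall>j\<le>d. U $$ (0,j) = 1 \<and> U $$ (j,0) = 1) \<and>
     \<nu> \<cdot>\<^sub>m (P * U * Pt * U\<^sup>T) = 1\<^sub>m (d+1)}"

text \<open>Only meaningful for invertible matrices: otherwise \<open>mat_inverse A\<close> is \<open>None\<close>.\<close>

definition minv :: "complex mat \<Rightarrow> complex mat" where
  "minv A = the (mat_inverse A)"

definition e :: "nat \<Rightarrow> nat \<Rightarrow> nat \<Rightarrow> complex mat" where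
  "e d i j = mat (d+1) (d+1) (\<lambda>(r, c). if r = i \<and> c = j then 1 else 0)"

definition \<phi> :: "nat \<Rightarrow> nat \<Rightarrow> complex mat" where
  "\<phi> d i = e d i i - (1 / of_nat (d+1)) \<cdot>\<^sub>m 1\<^sub>m (d+1)"

definition mat_span :: "nat \<Rightarrow> complex mat set \<Rightarrow> complex mat set" where
  "mat_span d S = LinearCombinations.module.span class_ring (module_mat TYPE(complex) (d+1) (d+1)) S"

definition H :: "nat \<Rightarrow> complex mat set" where
  "H d = mat_span d (\<phi> d ` {1..d})"

definition R :: "complex \<Rightarrow> complex mat \<Rightarrow> complex mat \<Rightarrow> complex mat" where
  "R \<theta>t Pt U = \<theta>t \<cdot>\<^sub>m (Pt * U\<^sup>T)"

definition et :: "nat \<Rightarrow> complex \<Rightarrow> complex mat \<Rightarrow> complex mat \<Rightarrow> nat \<Rightarrow> nat \<Rightarrow> complex mat" where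
  "et d \<theta>t Pt U i j = R \<theta>t Pt U * e d i j * minv (R \<theta>t Pt U)"

definition \<phi>t :: "nat \<Rightarrow> complex \<Rightarrow> complex mat \<Rightarrow> complex mat \<Rightarrow> nat \<Rightarrow> complex mat" where
  "\<phi>t d \<theta>t Pt U k = R \<theta>t Pt U * \<phi> d k * minv (R \<theta>t Pt U)"

definition Ht :: "nat \<Rightarrow> complex \<Rightarrow> complex mat \<Rightarrow> complex mat \<Rightarrow> complex mat set" where
  "Ht d \<theta>t Pt U = mat_span d (\<phi>t d \<theta>t Pt U ` {1..d})"

text \<open>
  The formula for the antiautomorphism makes sense for every square matrix; that it is an
  antiautomorphism of \<open>sl\<^sub>d\<^sub>+\<^sub>1\<close> is the lemma \<open>antiaut_sl\<close> below.
\<close>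

definition antiaut :: "complex mat \<Rightarrow> complex mat \<Rightarrow> complex mat" where
  "antiaut Pt \<beta> = Pt * \<beta>\<^sup>T * minv Pt"

definition sl :: "nat \<Rightarrow> complex mat set" where
  "sl n = {A \<in> carrier_mat n n. (\<Sum>i<n. A $$ (i,i)) = 0}"

definition lie_antiautomorphism :: "complex mat set \<Rightarrow> (complex mat \<Rightarrow> complex mat) \<Rightarrow> bool" where
  "lie_antiautomorphism L f \<longleftrightarrow> bij_betw f L L \<and>
     (\<forall>A\<in>L. \<forall>B\<in>L. f (A + B) = f A + f B) \<and>
     (\<forall>c. \<forall>A\<in>L. f (c \<cdot>\<^sub>m A) = c \<cdot>\<^sub>m f A) \<and>
     (\<forall>A\<in>L. \<forall>B\<in>L. f (A * B - B * A) = f B * f A - f A * f B)"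

lemma minv:
  assumes A: "A \<in> carrier_mat n n" and "det A \<noteq> 0"
  shows "A * minv A = 1\<^sub>m n" "minv A * A = 1\<^sub>m n" "minv A \<in> carrier_mat n n"
proof -
  have "A \<in> Units (ring_mat TYPE(complex) n ())"
    using assms by (rule det_non_zero_imp_unit)
  then obtain B where "mat_inverse A = Some B"
    using mat_inverse(1)[OF A, where b = "()"] by (cases "mat_inverse A") auto
  then show "A * minv A = 1\<^sub>m n" "minv A * A = 1\<^sub>m n" "minv A \<in> carrier_mat n n"
    using mat_inverse(2)[OF A] by (auto simp: minv_def)
qed

lemma K_set_det_nonzero:
  assumes "(\<nu>, P, Pt, U) \<in> K_set d"
  shows "det P \<noteq> 0" "det Pt \<noteq> 0" "det U \<noteq> 0"
proof -
  have c: "P \<in> carrier_mat (d+1) (d+1)" "Pt \<in> carrier_mat (d+1) (d+1)" "U \<in> carrier_mat (d+1) (d+1)"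
    and one: "\<nu> \<cdot>\<^sub>m (P * U * Pt * U\<^sup>T) = 1\<^sub>m (d+1)"
    using assms by (auto simp: K_set_def)
  have "det (\<nu> \<cdot>\<^sub>m (P * U * Pt * U\<^sup>T)) = \<nu> ^ (d+1) * (det P * det U * det Pt * det U)"
    using c by (simp add: det_mult[of _ "d+1"] det_transpose[of _ "d+1"])
  then have "\<nu> ^ (d+1) * (det P * det U * det Pt * det U) = 1"
    unfolding one by simp
  then show "det P \<noteq> 0" "det Pt \<noteq> 0" "det U \<noteq> 0"
    by auto
qed

lemma trace_mult_commute:
  fixes A B :: "complex mat"
  assumes "A \<in> carrier_mat n n" "B \<in> carrier_mat n n"
  shows "(\<Sum>i<n. (A * B) $$ (i,i)) = (\<Sum>i<n. (B * A) $$ (i,i))"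
proof -
  have "(\<Sum>i<n. (A * B) $$ (i,i)) = (\<Sum>i<n. \<Sum>k<n. A $$ (i,k) * B $$ (k,i))"
    using assms by (intro sum.cong) (auto simp: scalar_prod_def lessThan_atLeast0)
  also have "\<dots> = (\<Sum>k<n. \<Sum>i<n. B $$ (k,i) * A $$ (i,k))"
    by (subst sum.swap) (simp add: mult.commute)
  also have "\<dots> = (\<Sum>i<n. (B * A) $$ (i,i))"
    using assms by (intro sum.cong) (auto simp: scalar_prod_def lessThan_atLeast0)
  finally show ?thesis .
qed

lemma antiaut_sl:
  assumes K: "(\<nu>, P, Pt, U) \<in> K_set d"
  shows "lie_antiautomorphism (sl (d+1)) (antiaut Pt)"
proof -
  define n where "n = d + 1"
  define Q where "Q = minv Pt"
  have Pt: "Pt \<in> carrier_mat n n"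
    using K by (auto simp: K_set_def n_def)
  note Q = minv[OF Pt K_set_det_nonzero(2)[OF K], folded Q_def]
  have conj: "(Pt * X * Q) * (Pt * Y * Q) = Pt * (X * Y) * Q"
    if X: "X \<in> carrier_mat n n" and Y: "Y \<in> carrier_mat n n" for X Y
  proof -
    have "(Pt * X * Q) * (Pt * Y * Q) = Pt * X * (Q * Pt) * Y * Q"
      using Pt Q(3) X Y by (simp add: assoc_mult_mat[of _ n n _ n _ n])
    also have "\<dots> = Pt * (X * Y) * Q"
      using Pt Q X Y by (simp add: assoc_mult_mat[of _ n n _ n _ n])
    finally show ?thesis .
  qed
  have tr: "(\<Sum>i<n. (S * X * T) $$ (i,i)) = (\<Sum>i<n. X $$ (i,i))"
    if "S \<in> carrier_mat n n" "T \<in> carrier_mat n n" "X \<in> carrier_mat n n" "T * S = 1\<^sub>m n" for S T X :: "complex mat"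
  proof -
    have "(\<Sum>i<n. (S * X * T) $$ (i,i)) = (\<Sum>i<n. (T * (S * X)) $$ (i,i))"
      using that by (intro trace_mult_commute) auto
    also have "T * (S * X) = X"
      using that by (simp add: assoc_mult_mat[of _ n n _ n _ n, symmetric])
    finally show ?thesis .
  qed
  define g where "g = (\<lambda>\<gamma>. (Q * \<gamma> * Pt)\<^sup>T)"
  have bij: "bij_betw (antiaut Pt) (sl n) (sl n)"
  proof (rule bij_betwI[where g = g])
    show "antiaut Pt \<in> sl n \<rightarrow> sl n"
    proof
      fix A assume "A \<in> sl n"
      then have A: "A\<^sup>T \<in> carrier_mat n n" and "(\<Sum>i<n. A\<^sup>T $$ (i,i)) = 0"
        by (auto simp: sl_def)
      then show "antiaut Pt A \<in> sl n"
        using tr[OF Pt Q(3) A Q(2)] Pt Q(3)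
        unfolding sl_def antiaut_def Q_def[symmetric] mem_Collect_eq
        by (metis mult_carrier_mat)
    qed
    have "(\<Sum>i<n. g A $$ (i,i)) = (\<Sum>i<n. (Q * A * Pt) $$ (i,i))" if "A \<in> carrier_mat n n" for A
      using Pt Q that by (intro sum.cong) (auto simp: g_def)
    then have "(\<Sum>i<n. g A $$ (i,i)) = (\<Sum>i<n. A $$ (i,i))" if "A \<in> carrier_mat n n" for A
      using tr[OF Q(3) Pt that Q(1)] that by metis
    moreover have "g A \<in> carrier_mat n n" if "A \<in> carrier_mat n n" for A
      using Pt Q(3) that by (simp add: g_def)
    ultimately show "g \<in> sl n \<rightarrow> sl n"
      by (auto simp: sl_def)
    show "g (antiaut Pt A) = A" if "A \<in> sl n" for A
    proof -
      have A: "A\<^sup>T \<in> carrier_mat n n"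
        using that by (auto simp: sl_def)
      have "Q * (Pt * A\<^sup>T * Q) * Pt = (Q * Pt) * A\<^sup>T * (Q * Pt)"
        using Pt Q(3) A by (simp add: assoc_mult_mat[of _ n n _ n _ n])
      then show ?thesis
        using Q A by (simp add: g_def antiaut_def Q_def[symmetric])
    qed
    show "antiaut Pt (g A) = A" if "A \<in> sl n" for A
    proof -
      have A: "A \<in> carrier_mat n n"
        using that by (auto simp: sl_def)
      have "Pt * (Q * A * Pt) * Q = (Pt * Q) * A * (Pt * Q)"
        using Pt Q(3) A by (simp add: assoc_mult_mat[of _ n n _ n _ n])
      then show ?thesis
        using Q A by (simp add: g_def antiaut_def Q_def[symmetric])
    qed
  qed
  have add: "antiaut Pt (A + B) = antiaut Pt A + antiaut Pt B"
    if "A \<in> carrier_mat n n" "B \<in> carrier_mat n n" for A B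
    using that Pt Q(3)
    by (simp add: antiaut_def Q_def[symmetric] transpose_add[of _ n n]
        mult_add_distrib_mat[of _ n n _ n] add_mult_distrib_mat[of _ n n _ _ n])
  have smult: "antiaut Pt (c \<cdot>\<^sub>m A) = c \<cdot>\<^sub>m antiaut Pt A" if "A \<in> carrier_mat n n" for A c
  proof -
    have "(c \<cdot>\<^sub>m A)\<^sup>T = c \<cdot>\<^sub>m A\<^sup>T"
      by (rule eq_matI) auto
    then show ?thesis
      using that Pt Q(3)
      by (simp add: antiaut_def Q_def[symmetric] mult_smult_distrib[of _ n n _ n]
          mult_smult_assoc_mat[of _ n n _ n])
  qed
  have bracket: "antiaut Pt (A * B - B * A) = antiaut Pt B * antiaut Pt A - antiaut Pt A * antiaut Pt B"
    if A: "A \<in> carrier_mat n n" and B: "B \<in> carrier_mat n n" for A B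
  proof -
    have "(A * B - B * A)\<^sup>T = B\<^sup>T * A\<^sup>T - A\<^sup>T * B\<^sup>T"
      using A B
      by (simp add: transpose_minus[of _ n n] transpose_mult[of _ n n _ n])
    then have "antiaut Pt (A * B - B * A) = Pt * (B\<^sup>T * A\<^sup>T) * Q - Pt * (A\<^sup>T * B\<^sup>T) * Q"
      using A B Pt Q(3)
      by (simp add: antiaut_def Q_def[symmetric] mult_minus_distrib_mat[of _ n n _ n]
          minus_mult_distrib_mat[of _ n n _ _ n])
    moreover have "antiaut Pt B * antiaut Pt A = Pt * (B\<^sup>T * A\<^sup>T) * Q"
      "antiaut Pt A * antiaut Pt B = Pt * (A\<^sup>T * B\<^sup>T) * Q"
      using A B unfolding antiaut_def Q_def[symmetric] by (auto intro!: conj)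
    ultimately show ?thesis
      by simp
  qed
  show ?thesis
    unfolding lie_antiautomorphism_def n_def[symmetric]
    using bij add smult bracket by (auto simp: sl_def)
qed

end

(*
  Since U Pt U^T = (nu P)^{-1}, one has R P R^T = (theta^2 / nu) Pt: up to a scalar, R
  transforms the symmetric form P into Pt. Hence conjugation by R intertwines X |-> P X^T P^{-1}
  with the antiautomorphism X |-> Pt X^T Pt^{-1}, and the formulas with a tilde reduce to
  those for diagonal P. Both Cartan subalgebras are fixed pointwise.
*)
theory Submission
  imports Defs
begin

section \<open>Clearing inverses from the antiautomorphism\<close>

lemma minv_mult_cancel:
  assumes A: "A \<in> carrier_mat n n" and det: "det A \<noteq> 0" and B: "B \<in> carrier_mat n m"
  shows "minv A * (A * B) = B"
  using minv[OF A det] A B by (simp add: assoc_mult_mat[of _ n n _ n _ m, symmetric])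

text \<open>Multiplying by \<open>A\<close> on the right clears \<open>minv A\<close>, so a value of
  \<open>antiaut A\<close> can be verified by a product identity free of inverses.\<close>

lemma antiaut_eqI:
  assumes A: "A \<in> carrier_mat n n" and det: "det A \<noteq> 0"
    and B: "B \<in> carrier_mat n n" and eq: "A * X\<^sup>T = B * A"
  shows "antiaut A X = B"
proof -
  have "antiaut A X = B * (A * minv A)"
    using minv[OF A det] A B by (simp add: antiaut_def eq assoc_mult_mat[of _ n n _ n _ n])
  then show ?thesis
    using minv[OF A det] B by simp
qed

section \<open>Antiautomorphisms of diagonal matrices\<close>

lemma diagonal_mult_index:
  fixes D :: "'a::semiring_0 mat"
  assumes "diagonal_mat D" "D \<in> carrier_mat n n" "X \<in> carrier_mat n n" "i < n" "j < n"
  shows "(D * X) $$ (i,j) = D $$ (i,i) * X $$ (i,j)"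
    "(X * D) $$ (i,j) = X $$ (i,j) * D $$ (j,j)"
proof -
  have "(D * X) $$ (i,j) = (\<Sum>k\<in>{0..<n}. D $$ (i,k) * X $$ (k,j))"
    using assms by (simp add: scalar_prod_def)
  also have "\<dots> = (\<Sum>k\<in>{0..<n}. if k = i then D $$ (i,i) * X $$ (i,j) else 0)"
    using assms by (intro sum.cong) (auto simp: diagonal_mat_def)
  finally show "(D * X) $$ (i,j) = D $$ (i,i) * X $$ (i,j)"
    using assms by simp
  have "(X * D) $$ (i,j) = (\<Sum>k\<in>{0..<n}. X $$ (i,k) * D $$ (k,j))"
    using assms by (simp add: scalar_prod_def)
  also have "\<dots> = (\<Sum>k\<in>{0..<n}. if k = j then X $$ (i,j) * D $$ (j,j) else 0)"
    using assms by (intro sum.cong) (auto simp: diagonal_mat_def)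
  finally show "(X * D) $$ (i,j) = X $$ (i,j) * D $$ (j,j)"
    using assms by simp
qed

text \<open>The (i,i) entry of \<open>D * minv D\<close> is the product of the (i,i) entries of the
  factors, which exhibits an inverse of the diagonal entry.\<close>

lemma diagonal_index_nonzero:
  fixes D :: "complex mat"
  assumes D: "diagonal_mat D" "D \<in> carrier_mat n n" and det: "det D \<noteq> 0" and i: "i < n"
  shows "D $$ (i,i) \<noteq> 0"
proof -
  have "D $$ (i,i) * minv D $$ (i,i) = (D * minv D) $$ (i,i)"
    using diagonal_mult_index(1)[OF D minv(3)[OF D(2) det] i i] by simp
  also have "\<dots> = 1"
    using minv(1)[OF D(2) det] i by simp
  finally show ?thesis
    by auto
qed

lemma diagonal_transpose:
  assumes "diagonal_mat D" "D \<in> carrier_mat n n"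
  shows "D\<^sup>T = D"
proof (rule eq_matI)
  fix i j assume "i < dim_row D" "j < dim_col D"
  then show "D\<^sup>T $$ (i,j) = D $$ (i,j)"
    using assms by (cases "i = j") (auto simp: diagonal_mat_def)
qed (use assms in auto)

lemma e_carrier [simp]: "e d i j \<in> carrier_mat (Suc d) (Suc d)"
  by (simp add: e_def)

lemma \<phi>_carrier [simp]: "\<phi> d i \<in> carrier_mat (Suc d) (Suc d)"
  by (simp add: \<phi>_def minus_carrier_mat)

text \<open>Multiplying \<open>e d j i\<close> by \<open>D\<close> on the left scales it by the
  entry of row j, on the right by the entry of column i; the quotient balances the two. The cases
  \<open>D = Pt\<close> and \<open>D = P\<close> serve the plain and the tilde formula.\<close>

lemma antiaut_diagonal_e:
  assumes D: "diagonal_mat D" "D \<in> carrier_mat (d+1) (d+1)" and det: "det D \<noteq> 0"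
    and ij: "i \<le> d" "j \<le> d"
  shows "antiaut D (e d i j) = (D $$ (j,j) / D $$ (i,i)) \<cdot>\<^sub>m e d j i"
proof (rule antiaut_eqI[OF D(2) det])
  have nz: "D $$ (i,i) \<noteq> 0"
    using D det ij by (intro diagonal_index_nonzero) auto
  show "D * (e d i j)\<^sup>T = (D $$ (j,j) / D $$ (i,i)) \<cdot>\<^sub>m e d j i * D"
  proof (rule eq_matI)
    fix r c assume "r < dim_row ((D $$ (j,j) / D $$ (i,i)) \<cdot>\<^sub>m e d j i * D)"
      "c < dim_col ((D $$ (j,j) / D $$ (i,i)) \<cdot>\<^sub>m e d j i * D)"
    then have rc: "r < d+1" "c < d+1"
      using D by (auto simp: e_def)
    show "(D * (e d i j)\<^sup>T) $$ (r,c) = ((D $$ (j,j) / D $$ (i,i)) \<cdot>\<^sub>m e d j i * D) $$ (r,c)"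
      using nz rc diagonal_mult_index(1)[OF D _ rc, of "(e d i j)\<^sup>T"]
        diagonal_mult_index(2)[OF D _ rc, of "(D $$ (j,j) / D $$ (i,i)) \<cdot>\<^sub>m e d j i"]
      by (auto simp: e_def)
  qed (use D in \<open>auto simp: e_def\<close>)
qed simp

text \<open>\<open>\<phi> d i\<close> is diagonal, hence symmetric and commuting with
  \<open>D\<close>.\<close>

lemma antiaut_diagonal_\<phi>:
  assumes D: "diagonal_mat D" "D \<in> carrier_mat (d+1) (d+1)" and det: "det D \<noteq> 0"
  shows "antiaut D (\<phi> d i) = \<phi> d i"
proof (rule antiaut_eqI[OF D(2) det])
  show "D * (\<phi> d i)\<^sup>T = \<phi> d i * D"
  proof (rule eq_matI)
    fix r c assume "r < dim_row (\<phi> d i * D)" "c < dim_col (\<phi> d i * D)"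
    then have rc: "r < d+1" "c < d+1"
      using D by (auto simp: \<phi>_def)
    have "\<phi> d i \<in> carrier_mat (d+1) (d+1)" "(\<phi> d i)\<^sup>T \<in> carrier_mat (d+1) (d+1)"
      by simp_all
    then show "(D * (\<phi> d i)\<^sup>T) $$ (r,c) = (\<phi> d i * D) $$ (r,c)"
      using rc by (simp only: diagonal_mult_index[OF D _ rc]) (auto simp: \<phi>_def e_def)
  qed (use D in \<open>auto simp: \<phi>_def e_def\<close>)
qed simp

section \<open>Transport along a congruence\<close>

lemma antiaut_carrier:
  assumes "A \<in> carrier_mat n n" "det A \<noteq> 0" "X \<in> carrier_mat n n"
  shows "antiaut A X \<in> carrier_mat n n"
  using assms minv(3)[OF assms(1,2)] by (simp add: antiaut_def)

text \<open>In \<open>(c \<cdot>\<^sub>m A) * (S * X * minv S)\<^sup>T\<close> the congruence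
  replaces \<open>c \<cdot>\<^sub>m A\<close> by \<open>S * B * S\<^sup>T\<close>, whose last factor
  cancels the transposed inverse of \<open>S\<close>. What remains is
  \<open>S * B * X\<^sup>T * S\<^sup>T\<close>, and the other side of the criterion
  \<open>antiaut_eqI\<close>, multiplied by \<open>c\<close>, reduces to the same product.\<close>

lemma antiaut_conj:
  assumes A: "A \<in> carrier_mat n n" "det A \<noteq> 0" and B: "B \<in> carrier_mat n n" "det B \<noteq> 0"
    and S: "S \<in> carrier_mat n n" "det S \<noteq> 0"
    and congr: "S * B * S\<^sup>T = c \<cdot>\<^sub>m A" and X: "X \<in> carrier_mat n n"
  shows "antiaut A (S * X * minv S) = S * antiaut B X * minv S"
proof (rule antiaut_eqI[OF A])
  note sm = mult_smult_distrib[of _ n n _ n] mult_smult_assoc_mat[of _ n n _ n]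
  note as = assoc_mult_mat[of _ n n _ n _ n]
  note Q = minv(3)[OF S] and W = minv(3)[OF B]
  show "S * antiaut B X * minv S \<in> carrier_mat n n"
    using S Q antiaut_carrier[OF B X] by simp
  \<comment> \<open>Determinants in \<open>congr\<close> force \<open>c\<close> to be nonzero,
    except for n = 0, where matrices have no entries and cancelling \<open>c\<close> is
    trivial.\<close>
  have "det (S * B * S\<^sup>T) = det S * det B * det S"
    using S B by (simp add: det_mult[of _ n] det_transpose[of _ n])
  then have "c ^ n * det A \<noteq> 0 \<or> n = 0 \<and> c = 0"
    using S B A congr by (metis carrier_matD(2) det_smult mult_eq_0_iff)
  then have c: "c \<noteq> 0 \<or> n = 0"
    by (cases n) auto
  have 1: "minv S * (c \<cdot>\<^sub>m A) = B * S\<^sup>T"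
    unfolding congr[symmetric] using S B Q minv_mult_cancel[OF S, of _ n] by (simp add: as)
  have "S\<^sup>T * (minv S)\<^sup>T = (minv S * S)\<^sup>T"
    using S Q by (subst transpose_mult[of _ n n _ n]) auto
  then have inv: "S\<^sup>T * (minv S)\<^sup>T = 1\<^sub>m n"
    using minv(2)[OF S] by simp
  have 2: "(c \<cdot>\<^sub>m A) * (minv S)\<^sup>T = S * B"
    unfolding congr[symmetric] using S B Q inv by (simp add: as)
  \<comment> \<open>The scalar stays attached to \<open>A\<close>, so that facts \<open>1\<close>
    and \<open>2\<close>, the congruence with one outer factor removed, apply directly.\<close>
  have "S * antiaut B X * minv S * (c \<cdot>\<^sub>m A) = S * antiaut B X * (B * S\<^sup>T)"
    using S B Q A antiaut_carrier[OF B X] 1 by (simp add: as)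
  also have "\<dots> = S * (B * (X\<^sup>T * S\<^sup>T))"
    using S B W X minv_mult_cancel[OF B, of _ n] by (simp add: antiaut_def as)
  also have "\<dots> = ((c \<cdot>\<^sub>m A) * (minv S)\<^sup>T) * (X\<^sup>T * S\<^sup>T)"
    unfolding 2 using S B X by (simp add: as)
  also have "\<dots> = (c \<cdot>\<^sub>m A) * (S * X * minv S)\<^sup>T"
    using S A X Q by (simp add: as transpose_mult[of _ n n _ n])
  finally have eq: "c \<cdot>\<^sub>m (S * antiaut B X * minv S * A) = c \<cdot>\<^sub>m (A * (S * X * minv S)\<^sup>T)"
    using S A X Q antiaut_carrier[OF B X] by (simp add: sm)
  have cancel: "inverse c \<cdot>\<^sub>m (c \<cdot>\<^sub>m M) = M" if "M \<in> carrier_mat n n" for M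
    using c that by (intro eq_matI) auto
  have "A * (S * X * minv S)\<^sup>T \<in> carrier_mat n n"
    "S * antiaut B X * minv S * A \<in> carrier_mat n n"
    using S A X Q antiaut_carrier[OF B X] by (auto intro!: mult_carrier_mat[of _ n n])
  then show "A * (S * X * minv S)\<^sup>T = S * antiaut B X * minv S * A"
    using cancel eq by metis
qed

section \<open>Linearity and pointwise fixed spans\<close>

lemma antiaut_add:
  assumes A: "A \<in> carrier_mat n n" "det A \<noteq> 0" and "X \<in> carrier_mat n n" "Y \<in> carrier_mat n n"
  shows "antiaut A (X + Y) = antiaut A X + antiaut A Y"
  using assms minv(3)[OF A]
  by (simp add: antiaut_def transpose_add[of _ n n] mult_add_distrib_mat[of _ n n _ n]
      add_mult_distrib_mat[of _ n n _ _ n])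

lemma antiaut_smult:
  assumes A: "A \<in> carrier_mat n n" "det A \<noteq> 0" and "X \<in> carrier_mat n n"
  shows "antiaut A (c \<cdot>\<^sub>m X) = c \<cdot>\<^sub>m antiaut A X"
proof -
  have "(c \<cdot>\<^sub>m X)\<^sup>T = c \<cdot>\<^sub>m X\<^sup>T"
    by (rule eq_matI) auto
  then show ?thesis
    using assms minv(3)[OF A]
    by (simp add: antiaut_def mult_smult_distrib[of _ n n _ n] mult_smult_assoc_mat[of _ n n _ n])
qed

text \<open>By linearity the fixed matrices form a submodule, and the span is the least submodule
  containing \<open>S\<close>. As \<open>mat_span\<close> lives in the module of all matrices,
  linearity is used there, not just on \<open>sl\<close>.\<close>

lemma antiaut_fixes_span:
  assumes A: "A \<in> carrier_mat (d+1) (d+1)" "det A \<noteq> 0"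
    and S: "S \<subseteq> carrier_mat (d+1) (d+1)" and fixed: "\<And>X. X \<in> S \<Longrightarrow> antiaut A X = X"
    and X: "X \<in> mat_span d S"
  shows "antiaut A X = X"
proof -
  let ?M = "module_mat TYPE(complex) (d+1) (d+1)"
  let ?F = "{X \<in> carrier_mat (d+1) (d+1). antiaut A X = X}"
  interpret V: vectorspace class_ring ?M
    by (rule matrix_vs)
  have "antiaut A (0\<^sub>m (d+1) (d+1)) = 0\<^sub>m (d+1) (d+1)"
    using A minv(3)[OF A] by (simp add: antiaut_def)
  then have "LinearCombinations.submodule class_ring ?F ?M"
    unfolding submodule_def using V.module_axioms
    by (auto simp: module_mat_simps antiaut_add[OF A] antiaut_smult[OF A])
  then have "mat_span d S \<subseteq> ?F"
    unfolding mat_span_def using S fixed by (intro V.span_is_subset) auto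
  then show ?thesis
    using X by auto
qed

section \<open>Application to elements of \<open>K_set\<close>\<close>

text \<open>The left side is \<open>\<theta>t\<^sup>2\<close> times
  \<open>Pt * U\<^sup>T * P * U * Pt\<close>, and the defining relation of \<open>K_set\<close>,
  cyclically rotated, says that the first four factors multiply to 1/\<nu> times the
  identity.\<close>

lemma K_set_congr:
  assumes K: "(\<nu>, P, Pt, U) \<in> K_set d"
  shows "R \<theta>t Pt U * P * (R \<theta>t Pt U)\<^sup>T = (\<theta>t\<^sup>2 / \<nu>) \<cdot>\<^sub>m Pt"
proof -
  let ?n = "d + 1"
  note sm = mult_smult_distrib[of _ ?n ?n _ ?n] mult_smult_assoc_mat[of _ ?n ?n _ ?n]
  note as = assoc_mult_mat[of _ ?n ?n _ ?n _ ?n]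
  have c: "P \<in> carrier_mat ?n ?n" "Pt \<in> carrier_mat ?n ?n" "U \<in> carrier_mat ?n ?n"
    and diag: "diagonal_mat Pt" and \<nu>: "\<nu> \<noteq> 0"
    and one: "\<nu> \<cdot>\<^sub>m (P * U * Pt * U\<^sup>T) = 1\<^sub>m ?n"
    using K by (auto simp: K_set_def)
  have "(\<nu> \<cdot>\<^sub>m (P * U)) * (Pt * U\<^sup>T) = 1\<^sub>m ?n"
    using one c by (simp add: as sm)
  \<comment> \<open>The rotation: a one-sided inverse of a square matrix is two-sided, so the
    factors may be swapped.\<close>
  then have "(Pt * U\<^sup>T) * (\<nu> \<cdot>\<^sub>m (P * U)) = 1\<^sub>m ?n"
    using c by (elim mat_mult_left_right_inverse[rotated 2]) auto
  then have comm: "\<nu> \<cdot>\<^sub>m (Pt * (U\<^sup>T * (P * U))) = 1\<^sub>m ?n"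
    using c by (simp add: as sm)
  have "(R \<theta>t Pt U)\<^sup>T = \<theta>t \<cdot>\<^sub>m (U * Pt)"
  proof -
    have "(R \<theta>t Pt U)\<^sup>T = \<theta>t \<cdot>\<^sub>m (Pt * U\<^sup>T)\<^sup>T"
      by (rule eq_matI) (auto simp: R_def)
    then show ?thesis
      using c diagonal_transpose[OF diag c(2)] by (simp add: transpose_mult[of _ ?n ?n _ ?n])
  qed
  then have "R \<theta>t Pt U * P * (R \<theta>t Pt U)\<^sup>T = \<theta>t \<cdot>\<^sub>m (\<theta>t \<cdot>\<^sub>m ((Pt * (U\<^sup>T * (P * U))) * Pt))"
    using c by (simp add: R_def as sm)
  \<comment> \<open>Multiplying and dividing by \<open>\<nu>\<close> produces the left side of
    \<open>comm\<close>.\<close>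
  also have "\<dots> = (\<theta>t\<^sup>2 / \<nu>) \<cdot>\<^sub>m ((\<nu> \<cdot>\<^sub>m (Pt * (U\<^sup>T * (P * U)))) * Pt)"
    using c \<nu> by (intro eq_matI) (auto simp: sm power2_eq_square)
  finally show ?thesis
    unfolding comm using c by simp
qed

theorem lemma2p1:
  fixes d :: nat and \<nu> \<theta>t :: complex and P Pt U :: "complex mat"
  assumes "d \<ge> 1"
    and "(\<nu>, P, Pt, U) \<in> K_set d"
    and "det (R \<theta>t Pt U) = 1"
  shows "(\<forall>i\<in>{1..d}. antiaut Pt (\<phi> d i) = \<phi> d i \<and>
                    antiaut Pt (\<phi>t d \<theta>t Pt U i) = \<phi>t d \<theta>t Pt U i) \<and>
         (\<forall>i\<le>d. \<forall>j\<le>d. i \<noteq> j \<longrightarrow>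
           antiaut Pt (e d i j) = (Pt $$ (j,j) / Pt $$ (i,i)) \<cdot>\<^sub>m e d j i \<and>
           antiaut Pt (et d \<theta>t Pt U i j) = (P $$ (j,j) / P $$ (i,i)) \<cdot>\<^sub>m et d \<theta>t Pt U j i) \<and>
         antiaut Pt ` H d = H d \<and>
         antiaut Pt ` Ht d \<theta>t Pt U = Ht d \<theta>t Pt U"
proof -
  let ?n = "d + 1" and ?R = "R \<theta>t Pt U"
  have c: "P \<in> carrier_mat ?n ?n" "Pt \<in> carrier_mat ?n ?n" "U \<in> carrier_mat ?n ?n"
    and diag: "diagonal_mat P" "diagonal_mat Pt"
    using assms(2) by (auto simp: K_set_def)
  have R: "?R \<in> carrier_mat ?n ?n" "det ?R \<noteq> 0"
    using c assms(3) by (simp_all add: R_def)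
  note P = c(1) K_set_det_nonzero(1)[OF assms(2)]
  note Pt = c(2) K_set_det_nonzero(2)[OF assms(2)]
  \<comment> \<open>With \<open>S = R \<theta>t Pt U\<close>, \<open>A = Pt\<close> and
    \<open>B = P\<close>, conjugation by \<open>R\<close> carries \<open>antiaut P\<close> to
    \<open>antiaut Pt\<close>; this is why the tilde formula has entries of \<open>P\<close> as
    coefficients.\<close>
  note tr = antiaut_conj[OF Pt P R K_set_congr[OF assms(2)]]
  have \<phi>: "antiaut Pt (\<phi> d i) = \<phi> d i" for i
    by (rule antiaut_diagonal_\<phi>[OF diag(2) Pt])
  have \<phi>t: "antiaut Pt (\<phi>t d \<theta>t Pt U i) = \<phi>t d \<theta>t Pt U i" for i
    unfolding \<phi>t_def by (simp add: tr antiaut_diagonal_\<phi>[OF diag(1) P])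
  have \<phi>t_carrier: "\<phi>t d \<theta>t Pt U i \<in> carrier_mat ?n ?n" for i
    using R minv(3)[OF R] by (simp add: \<phi>t_def mult_carrier_mat[of _ _ "Suc d"])
  have "antiaut Pt (et d \<theta>t Pt U i j) = (P $$ (j,j) / P $$ (i,i)) \<cdot>\<^sub>m et d \<theta>t Pt U j i"
    if "i \<le> d" "j \<le> d" for i j
    unfolding et_def tr[OF e_carrier[unfolded Suc_eq_plus1]] antiaut_diagonal_e[OF diag(1) P that]
    using R minv(3)[OF R] e_carrier[of d j i]
    by (simp add: mult_smult_distrib[of _ ?n ?n _ ?n] mult_smult_assoc_mat[of _ ?n ?n _ ?n])
  \<comment> \<open>Acting as the identity on \<open>H\<close> and on \<open>Ht\<close> yields the
    two image equalities.\<close>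
  moreover have "antiaut Pt X = X" if "X \<in> H d" for X
    by (rule antiaut_fixes_span[OF Pt _ _ that[unfolded H_def]]) (auto simp: \<phi>)
  moreover have "antiaut Pt X = X" if "X \<in> Ht d \<theta>t Pt U" for X
    by (rule antiaut_fixes_span[OF Pt _ _ that[unfolded Ht_def]])
      (use \<phi>t_carrier in \<open>auto simp: \<phi>t\<close>)
  ultimately show ?thesis
    using \<phi> \<phi>t antiaut_diagonal_e[OF diag(2) Pt] by simp
qed

end
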